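(* If $A \subset \mathbb{R}^d$ is a set of finite perimeter, then for every $\alpha \in (0,1)$ one has $$\tilde{P}_\alpha(A) \leq |A|^{1-\alpha}\, \operatorname{Per}(A)^\alpha,$$ and $$\lim_{\alpha \to 0} \tilde{P}_\alpha(A) = |A| \quad \text{and} \quad \lim_{\alpha \to 1} \tilde{P}_\alpha(A) = \operatorname{Per}(A).$$
   Context: Here $d \ge 1$ and $\alpha \in (0,1)$. $|E|$ denotes the Lebesgue measure of a measurable set $E \subset \mathbb{R}^d$ and $\chi_E$ its characteristic function. For $f \in L^1_{\mathrm{loc}}(\mathbb{R}^d)$, $|Df|(\mathbb{R}^d) \in [0,\infty]$ denotes the total variation of its distributional gradient, that is, $|Df|(\mathbb{R}^d) = \sup\{ \int_{\mathbb{R}^d} f \operatorname{div}\Phi \, dx : \Phi \in C_c^\infty(\mathbb{R}^d;\mathbb{R}^d),\ |\Phi| \le 1 \}$. The homogeneous space $\dot{BV}(\mathbb{R}^d)$ consists of the functions $f \in L^1_{\mathrm{loc}}(\mathbb{R}^d)$ with $|Df|(\mathbb{R}^d) < \infty$. The perimeter (in the sense of De Giorgi) of a measurable set $E$ is $\operatorname{Per}(E) := |D\chi_E|(\mathbb{R}^d)$, and $E$ is a set of finite perimeter if it is Lebesgue measurable and $\operatorname{Per}(E) < \infty$. For a function $f$ and $t > 0$, the $K$-functional is $$K(t, f, L^1, \dot{BV}) := \inf_{f = f_1 + f_2} \|f_1\|_{L^1(\mathbb{R}^d)} + t\, |Df_2|(\mathbb{R}^d),$$ where the infimum is over all decompositions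 $f = f_1 + f_2$ with $f_1 \in L^1(\mathbb{R}^d)$ and $f_2 \in \dot{BV}(\mathbb{R}^d)$. For a measurable set $A \subset \mathbb{R}^d$ and $\alpha \in (0,1)$, the fractional perimeter intrinsic to interpolation is $$\tilde{P}_\alpha(A) := \alpha(1-\alpha) \int_0^\infty t^{-\alpha} K(t, \chi_A, L^1, \dot{BV}) \, \frac{dt}{t}.$$
   Formalization: The limit as α→0 is stated for |A| finite, and the limit as α→1 when A or its complement has finite measure; without this they fail: for A = R^d, P̃_α = 0 but |A| = ∞, and for a half-line P̃_α = ∞ but Per(A) = 1. *)

theory Defs
  imports "HOL-Analysis.Analysis"
begin

text \<open>The space $R^d$ is rendered by a type of class \<open>euclidean_space\<close>; its dimension
  \<open>DIM('a)\<close> is an arbitrary integer $d \ge 1$.\<close>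

fun times_differentiable :: "nat \<Rightarrow> ('a::real_normed_vector \<Rightarrow> 'b::real_normed_vector) \<Rightarrow> bool" where
  "times_differentiable 0 f \<longleftrightarrow> continuous_on UNIV f"
| "times_differentiable (Suc k) f \<longleftrightarrow>
     (\<forall>x. f differentiable (at x)) \<and>
     (\<forall>v. times_differentiable k (\<lambda>x. frechet_derivative f (at x) v))"

definition smooth :: "('a::real_normed_vector \<Rightarrow> 'b::real_normed_vector) \<Rightarrow> bool" where
  "smooth f \<longleftrightarrow> (\<forall>k. times_differentiable k f)"

definition compactly_supported :: "('a::topological_space \<Rightarrow> 'b::zero) \<Rightarrow> bool" where
  "compactly_supported f \<longleftrightarrow> compact (closure {x. f x \<noteq> 0})"

definition divergence :: "('a::euclidean_space \<Rightarrow> 'a) \<Rightarrow> 'a \<Rightarrow> real" where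
  "divergence \<Phi> x = (\<Sum>b\<in>Basis. frechet_derivative \<Phi> (at x) b \<bullet> b)"

definition L1_loc :: "('a::euclidean_space \<Rightarrow> real) set" where
  "L1_loc = {f. \<forall>C. compact C \<longrightarrow> set_integrable lebesgue C f}"

definition test_fields :: "('a::euclidean_space \<Rightarrow> 'a) set" where
  "test_fields = {\<Phi>. smooth \<Phi> \<and> compactly_supported \<Phi> \<and> (\<forall>x. norm (\<Phi> x) \<le> 1)}"

text \<open>The coercion \<open>ennreal\<close> sends negative reals to \<open>0\<close>. This does not affect the supremum,
  because \<open>\<Phi> = 0\<close> contributes the value \<open>0\<close>. The notion is meaningful for \<open>f \<in> L1_loc\<close>.\<close>

definition total_variation :: "('a::euclidean_space \<Rightarrow> real) \<Rightarrow> ennreal" where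
  "total_variation f = (SUP \<Phi>\<in>test_fields. ennreal (\<integral>x. f x * divergence \<Phi> x \<partial>lebesgue))"

definition BV_dot :: "('a::euclidean_space \<Rightarrow> real) set" where
  "BV_dot = {f \<in> L1_loc. total_variation f < \<infinity>}"

definition perimeter :: "'a::euclidean_space set \<Rightarrow> ennreal" where
  "perimeter E = total_variation (indicator E)"

definition finite_perimeter :: "'a::euclidean_space set \<Rightarrow> bool" where
  "finite_perimeter E \<longleftrightarrow> E \<in> sets lebesgue \<and> perimeter E < \<infinity>"

text \<open>Elements of the function spaces are functions, not equivalence classes, so the
  decomposition is required almost everywhere. The infimum of the empty set is \<open>\<infinity>\<close>.\<close>

definition K_functional :: "real \<Rightarrow> ('a::euclidean_space \<Rightarrow> real) \<Rightarrow> ennreal" where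
  "K_functional t f =
     (INF (f1, f2) \<in> {(f1, f2). integrable lebesgue f1 \<and> f2 \<in> BV_dot \<and>
                                (AE x in lebesgue. f x = f1 x + f2 x)}.
        (\<integral>\<^sup>+x. ennreal \<bar>f1 x\<bar> \<partial>lebesgue) + ennreal t * total_variation f2)"

definition fractional_perimeter :: "real \<Rightarrow> 'a::euclidean_space set \<Rightarrow> ennreal" where
  "fractional_perimeter \<alpha> A =
     ennreal (\<alpha> * (1 - \<alpha>)) *
     (\<integral>\<^sup>+t\<in>{0<..}. (ennreal (t powr (- \<alpha>)) * K_functional t (indicator A) * ennreal (1 / t)) \<partial>lborel)"

text \<open>Powers of extended nonnegative reals, for exponents \<open>p > 0\<close> only. With the convention
  \<open>0 * \<infinity> = 0\<close> of \<open>ennreal\<close>, a product of such powers vanishes if one of the bases does.\<close>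

definition ennreal_powr :: "ennreal \<Rightarrow> real \<Rightarrow> ennreal" where
  "ennreal_powr x p = (if x = \<infinity> then \<infinity> else ennreal (enn2real x powr p))"

end

theory Submission
  imports Defs
begin

text \<open>
  Everything rests on three bounds from above and one bound from below for the K-functional
  \<open>K t\<close> of the indicator function \<open>\<chi>\<close> of \<open>A\<close>.

  The bounds from above come from the trivial decompositions: \<open>\<chi> = \<chi> + 0\<close> gives \<open>K t \<le> |A|\<close>,
  \<open>\<chi> = 0 + \<chi>\<close> gives \<open>K t \<le> t Per(A)\<close>, and \<open>\<chi> = (\<chi> - 1) + 1\<close> gives \<open>K t \<le> |-A|\<close>, because
  constants have no variation. If \<open>K t\<close> is below both \<open>m\<close> and \<open>t P\<close>, splitting the integral over
  \<open>t\<close> at the crossing point \<open>m / P\<close> yields exactly \<open>m powr (1 - \<alpha>) * P powr \<alpha>\<close>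
  (\<open>fractional_perimeter_le\<close>). This is the inequality for \<open>|A| < \<infinity>\<close>; for \<open>|A| = \<infinity>\<close> its right-hand
  side is infinite unless \<open>Per(A) = 0\<close>, and then \<open>K\<close> vanishes. The same estimate bounds both limits
  from above. There, the factor whose exponent tends to \<open>0\<close> is first enlarged to \<open>m + 1\<close> or
  \<open>P + 1\<close>, because a vanishing base would give \<open>0\<close> instead of the limit \<open>1\<close>.

  The bound from below is duality (\<open>K_functional_ge_flux\<close>): for each smooth compactly supported
  field \<open>\<Psi>\<close> with \<open>|\<Psi>| \<le> t\<close> and \<open>|div \<Psi>| \<le> 1\<close>, the integral of \<open>div \<Psi>\<close> over \<open>A\<close> is at most
  \<open>K t\<close>. It is used at the two ends of the scale of \<open>t\<close>.

  For small \<open>t\<close>, take \<open>\<Psi> = t \<Phi>\<close> with a test field \<open>\<Phi>\<close> that is nearly optimal for the perimeter: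
  once \<open>t |div \<Phi>| \<le> 1\<close>, one gets \<open>K t \<ge> t c\<close> with \<open>c\<close> close to \<open>Per(A)\<close>. As \<open>\<alpha>\<close> tends to \<open>1\<close>,
  the weight concentrates at \<open>t = 0\<close>, and \<open>fractional_perimeter_ge_near_0\<close> gives the lower half
  of the second limit.

  For large \<open>t\<close>, fix a field \<open>\<Psi>\<close> whose divergence attains its maximal modulus \<open>1\<close> at the
  origin. The dilations \<open>n \<Psi>(x / n)\<close> have divergence \<open>div \<Psi>(x / n)\<close>, which stays bounded
  by \<open>1\<close> and tends to \<open>1\<close> everywhere. If \<open>|A|\<close> is finite, the flux through \<open>A\<close> tends to
  \<open>|A|\<close> by dominated convergence, so \<open>K t\<close> tends to \<open>|A|\<close> as \<open>t\<close> grows. As \<open>\<alpha>\<close> tends to \<open>0\<close> the weight moves to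
  infinity, and \<open>fractional_perimeter_ge_near_infinity\<close> gives the lower half of the first limit.
  This argument takes the place of the isoperimetric inequality: a set of finite measure with zero
  perimeter has \<open>K t = 0\<close> and hence measure zero.
\<close>

section \<open>Smooth functions\<close>

lemma times_differentiable_SucI:
  assumes "\<And>x. (f has_derivative f' x) (at x)"
    and "\<And>v. times_differentiable k (\<lambda>x. f' x v)"
  shows "times_differentiable (Suc k) f"
proof -
  have "frechet_derivative f (at x) = f' x" for x
    using frechet_derivative_at[OF assms(1)] by simp
  then show ?thesis
    using assms by (auto simp: differentiable_def)
qed

lemma times_differentiable_has_derivative:
  assumes "times_differentiable (Suc k) f"
  shows "(f has_derivative frechet_derivative f (at x)) (at x)"
  using assms by (simp add: frechet_derivative_works)

lemma times_differentiable_SucD: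
  "times_differentiable (Suc k) f \<Longrightarrow> times_differentiable k f"
proof (induction k arbitrary: f)
  case 0
  then show ?case
    by (auto intro!: continuous_at_imp_continuous_on differentiable_imp_continuous_within)
next
  case (Suc k)
  from Suc.prems show ?case
    unfolding times_differentiable.simps(2)[of "Suc k"] times_differentiable.simps(2)[of k f]
    using Suc.IH by blast
qed

lemma times_differentiable_const: "times_differentiable k (\<lambda>_. c)"
proof (induction k arbitrary: c)
  case (Suc k)
  show ?case
    by (rule times_differentiable_SucI[where f' = "\<lambda>_ _. 0"]) (auto simp: Suc.IH)
qed auto

lemma times_differentiable_add:
  "times_differentiable k f \<Longrightarrow> times_differentiable k g \<Longrightarrow> times_differentiable k (\<lambda>x. f x + g x)"
proof (induction k arbitrary: f g)
  case 0
  then show ?case by (auto intro: continuous_on_add)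
next
  case (Suc k)
  show ?case
  proof (rule times_differentiable_SucI)
    show "((\<lambda>x. f x + g x) has_derivative
        (\<lambda>v. frechet_derivative f (at x) v + frechet_derivative g (at x) v)) (at x)" for x
      by (intro has_derivative_add times_differentiable_has_derivative[OF Suc.prems(1)]
          times_differentiable_has_derivative[OF Suc.prems(2)])
    show "times_differentiable k
        (\<lambda>x. frechet_derivative f (at x) v + frechet_derivative g (at x) v)" for v
      using Suc by auto
  qed
qed

text \<open>Differentiating the product yields products of the factors with derivatives, so the induction
  also needs the factors at the lower order; this is \<open>times_differentiable_SucD\<close>.\<close>

lemma times_differentiable_scaleR:
  fixes f :: "'a::real_normed_vector \<Rightarrow> real"
  shows "times_differentiable k f \<Longrightarrow> times_differentiable k g \<Longrightarrow>
    times_differentiable k (\<lambda>x. f x *\<^sub>R g x)"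
proof (induction k arbitrary: f g)
  case 0
  then show ?case by (auto intro: continuous_on_scaleR)
next
  case (Suc k)
  show ?case
  proof (rule times_differentiable_SucI)
    show "((\<lambda>x. f x *\<^sub>R g x) has_derivative
        (\<lambda>v. f x *\<^sub>R frechet_derivative g (at x) v + frechet_derivative f (at x) v *\<^sub>R g x)) (at x)" for x
      by (intro has_derivative_scaleR times_differentiable_has_derivative[OF Suc.prems(1)]
          times_differentiable_has_derivative[OF Suc.prems(2)])
    show "times_differentiable k
        (\<lambda>x. f x *\<^sub>R frechet_derivative g (at x) v + frechet_derivative f (at x) v *\<^sub>R g x)" for v
      using Suc.prems times_differentiable_SucD[OF Suc.prems(1)] times_differentiable_SucD[OF Suc.prems(2)]
      by (intro times_differentiable_add Suc.IH) auto
  qed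
qed

lemma has_derivative_rescale:
  assumes "\<And>y. f differentiable (at y)"
  shows "((\<lambda>x. c *\<^sub>R f (p + r *\<^sub>R x)) has_derivative
      (\<lambda>v. (c * r) *\<^sub>R frechet_derivative f (at (p + r *\<^sub>R x)) v)) (at x)"
proof -
  let ?D = "frechet_derivative f (at (p + r *\<^sub>R x))"
  have D: "(f has_derivative ?D) (at (p + r *\<^sub>R x))"
    using assms frechet_derivative_works by blast
  have "((\<lambda>x. p + r *\<^sub>R x) has_derivative (\<lambda>v. r *\<^sub>R v)) (at x)"
    by (auto intro!: derivative_eq_intros)
  from has_derivative_scaleR_right[OF has_derivative_compose[OF this D], of c]
  show ?thesis
    using linear_cmul[OF has_derivative_linear[OF D]] by simp
qed

lemma times_differentiable_rescale:
  "times_differentiable k f \<Longrightarrow> times_differentiable k (\<lambda>x. c *\<^sub>R f (p + r *\<^sub>R x))"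
proof (induction k arbitrary: f c)
  case 0
  then show ?case
    by (auto intro!: continuous_intros intro: continuous_on_compose2)
next
  case (Suc k)
  show ?case
    by (rule times_differentiable_SucI[OF has_derivative_rescale])
      (use Suc in auto)
qed

text \<open>The classical flat function \<open>exp (-1/s)\<close>, extended by \<open>0\<close>, times \<open>1/s^k\<close>. The index \<open>k\<close> makes the family closed under differentiation, so that smoothness can be
  proved for all members at once.\<close>

definition flat_exp :: "nat \<Rightarrow> real \<Rightarrow> real" where
  "flat_exp k s = (if s \<le> 0 then 0 else exp (- inverse s) * inverse s ^ k)"

lemma flat_exp_at_0: "flat_exp k 0 = 0"
  by (simp add: flat_exp_def)

lemma flat_exp_over: "flat_exp k s / s = flat_exp (Suc k) s"
  by (simp add: flat_exp_def divide_inverse)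

lemma flat_exp_tendsto_0: "(flat_exp k \<longlongrightarrow> 0) (at 0)"
proof (rule filterlim_split_at)
  show "(flat_exp k \<longlongrightarrow> 0) (at_left 0)"
    by (rule tendsto_eventually) (auto simp: flat_exp_def eventually_at_filter)
  have "((\<lambda>s. inverse s ^ k / exp (inverse s)) \<longlongrightarrow> 0) (at_right (0::real))"
    by (rule filterlim_compose[OF tendsto_power_div_exp_0 filterlim_inverse_at_top_right])
  moreover have "\<forall>\<^sub>F s in at_right 0. inverse s ^ k / exp (inverse s) = flat_exp k s"
    by (auto simp: flat_exp_def eventually_at_filter exp_minus divide_inverse)
  ultimately show "(flat_exp k \<longlongrightarrow> 0) (at_right 0)"
    by (rule Lim_transform_eventually)
qed

text \<open>At the origin the difference quotient is again a member of the family, which tends to \<open>0\<close>.\<close>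

lemma DERIV_flat_exp:
  "(flat_exp k has_real_derivative flat_exp (k + 2) s - k * flat_exp (k + 1) s) (at s)"
proof (cases s "0::real" rule: linorder_cases)
  case less
  have "((\<lambda>_. 0) has_real_derivative 0) (at s)" by simp
  then have "(flat_exp k has_real_derivative 0) (at s)"
    by (rule has_field_derivative_transform_within_open[where S = "{..<0}"])
      (use less in \<open>auto simp: flat_exp_def\<close>)
  then show ?thesis using less by (simp add: flat_exp_def)
next
  case equal
  have "((\<lambda>h. (flat_exp k (0 + h) - flat_exp k 0) / h) \<longlongrightarrow> 0) (at 0)"
    using flat_exp_tendsto_0[of "Suc k"] flat_exp_over[of k] by (simp add: flat_exp_at_0)
  then show ?thesis using equal by (simp add: flat_exp_at_0 DERIV_def)
next
  case greater
  let ?u = "inverse s"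
  have "((\<lambda>s. exp (- inverse s) * inverse s ^ k) has_real_derivative
      exp (- ?u) * ?u\<^sup>2 * ?u ^ k + exp (- ?u) * (k * ?u ^ (k - 1) * (- ?u\<^sup>2))) (at s)"
    using greater by (auto intro!: derivative_eq_intros simp: power2_eq_square)
  also have "exp (- ?u) * ?u\<^sup>2 * ?u ^ k + exp (- ?u) * (k * ?u ^ (k - 1) * (- ?u\<^sup>2))
      = flat_exp (k + 2) s - k * flat_exp (k + 1) s"
    using greater by (cases k) (auto simp: flat_exp_def power2_eq_square)
  finally show ?thesis
    by (rule has_field_derivative_transform_within_open[where S = "{0<..}"])
      (use greater in \<open>auto simp: flat_exp_def\<close>)
qed

lemma has_derivative_bump:
  fixes x :: "'a::euclidean_space"
  shows "((\<lambda>x. flat_exp k (1 - x \<bullet> x)) has_derivative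
     (\<lambda>v. (flat_exp (k + 2) (1 - x \<bullet> x) - k * flat_exp (k + 1) (1 - x \<bullet> x)) * (- 2 * (x \<bullet> v)))) (at x)"
proof -
  have "((\<lambda>x::'a. 1 - x \<bullet> x) has_derivative (\<lambda>v. - 2 * (x \<bullet> v))) (at x)"
    by (auto intro!: derivative_eq_intros simp: inner_commute)
  from has_derivative_compose[OF this DERIV_flat_exp[unfolded has_field_derivative_def]]
  show ?thesis by simp
qed

text \<open>A directional derivative of a bump is a combination of bumps times a linear function, so
  induction on the order of differentiability works for all indices simultaneously.\<close>

lemma times_differentiable_bump:
  "times_differentiable n (\<lambda>x::'a::euclidean_space. flat_exp k (1 - x \<bullet> x))"
proof (induction n arbitrary: k)
  case 0
  show ?case
    using has_derivative_bump[where 'a='a]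
    by (auto intro!: continuous_at_imp_continuous_on has_derivative_continuous)
next
  case (Suc n)
  show ?case
  proof (rule times_differentiable_SucI[OF has_derivative_bump])
    fix v :: 'a
    have "times_differentiable n (\<lambda>x::'a. x \<bullet> v)"
    proof (cases n)
      case (Suc m)
      have "((\<lambda>x::'a. x \<bullet> v) has_derivative (\<lambda>w. w \<bullet> v)) (at x)" for x
        by (auto intro!: derivative_eq_intros)
      then show ?thesis
        unfolding Suc by (rule times_differentiable_SucI) (rule times_differentiable_const)
    qed (auto intro!: continuous_intros)
    then have lin: "times_differentiable n (\<lambda>x::'a. - 2 * (x \<bullet> v))"
      using times_differentiable_scaleR[OF times_differentiable_const, of n "\<lambda>x. x \<bullet> v" "- 2"] by simp
    have "times_differentiable n (\<lambda>x::'a. flat_exp (k + 2) (1 - x \<bullet> x)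
        + (- real k) *\<^sub>R flat_exp (k + 1) (1 - x \<bullet> x))"
      by (intro times_differentiable_add times_differentiable_scaleR times_differentiable_const Suc.IH)
    from times_differentiable_scaleR[OF this lin]
    show "times_differentiable n (\<lambda>x::'a. (flat_exp (k + 2) (1 - x \<bullet> x)
        - k * flat_exp (k + 1) (1 - x \<bullet> x)) * (- 2 * (x \<bullet> v)))"
      by simp
  qed
qed

section \<open>Smooth compactly supported vector fields\<close>

text \<open>The test fields without their bound \<open>1\<close>. Unlike \<open>test_fields\<close>, this class is closed under
  dilations and multiples.\<close>

locale compact_field =
  fixes \<Phi> :: "'a::euclidean_space \<Rightarrow> 'a"
  assumes smooth: "smooth \<Phi>" and supp: "compactly_supported \<Phi>"
begin

abbreviation "S \<equiv> closure {x. \<Phi> x \<noteq> 0}"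

lemma times_differentiable_field: "times_differentiable k \<Phi>"
  using smooth by (simp add: smooth_def)

lemma differentiable: "\<Phi> differentiable (at x)"
  using times_differentiable_field[of 1] by (simp add: numeral_eq_Suc)

lemma continuous: "continuous_on UNIV \<Phi>"
  using times_differentiable_field[of 0] by simp

lemma has_derivative: "(\<Phi> has_derivative frechet_derivative \<Phi> (at x)) (at x)"
  using differentiable frechet_derivative_works by blast

lemma continuous_derivative: "continuous_on UNIV (\<lambda>x. frechet_derivative \<Phi> (at x) v)"
  using times_differentiable_field[of 1] by simp

lemma outside: "x \<notin> S \<Longrightarrow> \<Phi> x = 0"
  using closure_subset[of "{x. \<Phi> x \<noteq> 0}"] by blast

lemma derivative_outside:
  assumes "x \<notin> S" shows "frechet_derivative \<Phi> (at x) = (\<lambda>_. 0)"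
proof -
  have "((\<lambda>_. 0) has_derivative (\<lambda>_. 0)) (at x)" by simp
  then have "(\<Phi> has_derivative (\<lambda>_. 0)) (at x)"
    by (rule has_derivative_transform_within_open[where s = "- S"])
      (use assms closure_subset[of "{x. \<Phi> x \<noteq> 0}"] in \<open>auto simp: open_Compl\<close>)
  then show ?thesis by (metis frechet_derivative_at)
qed

lemma continuous_divergence: "continuous_on UNIV (divergence \<Phi>)"
  unfolding divergence_def by (intro continuous_intros continuous_derivative)

lemma divergence_outside: "x \<notin> S \<Longrightarrow> divergence \<Phi> x = 0"
  by (simp add: divergence_def derivative_outside)

lemma bounded_of_continuous:
  fixes g :: "'a \<Rightarrow> 'b::real_normed_vector"
  assumes "continuous_on UNIV g" "\<And>x. x \<notin> S \<Longrightarrow> g x = 0"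
  obtains M where "M > 0" "\<And>x. norm (g x) \<le> M"
proof -
  have "compact (g ` S)"
    using supp continuous_on_subset[OF assms(1)]
    by (auto simp: compactly_supported_def intro: compact_continuous_image)
  then have "bounded (g ` S)" by (rule compact_imp_bounded)
  then obtain M where "M > 0" "\<And>x. x \<in> S \<Longrightarrow> norm (g x) \<le> M"
    unfolding bounded_pos by blast
  then show ?thesis using that[of M] assms(2) by (metis less_imp_le norm_zero)
qed

text \<open>With \<open>c = 1 / r\<close> the divergence is only dilated, while the field itself is also multiplied
  by \<open>1 / r\<close>.\<close>

lemma divergence_rescale:
  "divergence (\<lambda>x. c *\<^sub>R \<Phi> (p + r *\<^sub>R x)) x = c * r * divergence \<Phi> (p + r *\<^sub>R x)"
proof -
  have "frechet_derivative (\<lambda>x. c *\<^sub>R \<Phi> (p + r *\<^sub>R x)) (at x)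
      = (\<lambda>v. (c * r) *\<^sub>R frechet_derivative \<Phi> (at (p + r *\<^sub>R x)) v)"
    using frechet_derivative_at[OF has_derivative_rescale[OF differentiable]] by simp
  then show ?thesis by (simp add: divergence_def sum_distrib_left)
qed

lemma compact_field_rescale:
  assumes "r \<noteq> 0" shows "compact_field (\<lambda>x. c *\<^sub>R \<Phi> (p + r *\<^sub>R x))"
proof
  show "smooth (\<lambda>x. c *\<^sub>R \<Phi> (p + r *\<^sub>R x))"
    unfolding smooth_def by (intro allI times_differentiable_rescale times_differentiable_field)
  have "compact ((\<lambda>y. (1 / r) *\<^sub>R (y - p)) ` S)"
    using supp by (intro compact_continuous_image continuous_intros) (simp add: compactly_supported_def)
  moreover have "{x. c *\<^sub>R \<Phi> (p + r *\<^sub>R x) \<noteq> 0} \<subseteq> (\<lambda>y. (1 / r) *\<^sub>R (y - p)) ` S"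
  proof
    fix x assume "x \<in> {x. c *\<^sub>R \<Phi> (p + r *\<^sub>R x) \<noteq> 0}"
    then have "p + r *\<^sub>R x \<in> S"
      using closure_subset[of "{x. \<Phi> x \<noteq> 0}"] by auto
    moreover have "x = (1 / r) *\<^sub>R ((p + r *\<^sub>R x) - p)"
      using assms by simp
    ultimately show "x \<in> (\<lambda>y. (1 / r) *\<^sub>R (y - p)) ` S" by blast
  qed
  ultimately show "compactly_supported (\<lambda>x. c *\<^sub>R \<Phi> (p + r *\<^sub>R x))"
    unfolding compactly_supported_def
    by (meson bounded_subset compact_closure compact_imp_bounded)
qed

end

text \<open>Take a bump in a coordinate direction \<open>e\<close>: its divergence is the derivative in direction \<open>e\<close>,
  which is strictly negative at \<open>e / 2\<close>.\<close>

lemma compact_field_nonzero_divergence: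
  obtains \<Psi> :: "'a::euclidean_space \<Rightarrow> 'a" and x where "compact_field \<Psi>" "divergence \<Psi> x \<noteq> 0"
proof -
  obtain e :: 'a where e: "e \<in> Basis" using nonempty_Basis by blast
  define \<Psi> :: "'a \<Rightarrow> 'a" where "\<Psi> = (\<lambda>x. flat_exp 0 (1 - x \<bullet> x) *\<^sub>R e)"
  have sm: "smooth \<Psi>"
    unfolding smooth_def \<Psi>_def
    by (intro allI times_differentiable_scaleR[OF times_differentiable_bump times_differentiable_const])
  have "{x. \<Psi> x \<noteq> 0} \<subseteq> cball 0 1"
  proof
    fix x assume "x \<in> {x. \<Psi> x \<noteq> 0}"
    then have "x \<bullet> x \<le> 1" by (auto simp: \<Psi>_def flat_exp_def split: if_splits)
    then show "x \<in> cball 0 1" by (simp add: norm_le_square)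
  qed
  then have "compactly_supported \<Psi>"
    unfolding compactly_supported_def by (meson bounded_cball bounded_subset compact_closure)
  with sm have cf: "compact_field \<Psi>" by (simp add: compact_field_def)
  define x where "x = (1/2) *\<^sub>R e"
  have "(\<Psi> has_derivative (\<lambda>v. (flat_exp 2 (1 - x \<bullet> x) * (- 2 * (x \<bullet> v))) *\<^sub>R e)) (at x)"
    unfolding \<Psi>_def using has_derivative_scaleR_left[OF has_derivative_bump[of 0 x], of e]
    by (simp add: numeral_2_eq_2)
  then have "frechet_derivative \<Psi> (at x) = (\<lambda>v. (flat_exp 2 (1 - x \<bullet> x) * (- 2 * (x \<bullet> v))) *\<^sub>R e)"
    by (metis frechet_derivative_at)
  then have "divergence \<Psi> x = (\<Sum>b\<in>Basis. flat_exp 2 (1 - x \<bullet> x) * (- 2 * (x \<bullet> b)) * (e \<bullet> b))"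
    by (simp add: divergence_def)
  also have "\<dots> = (\<Sum>b\<in>Basis. if b = e then - flat_exp 2 (3/4) else 0)"
    using e by (intro sum.cong) (auto simp: x_def inner_Basis)
  also have "\<dots> = - flat_exp 2 (3/4)" using e by simp
  also have "\<dots> \<noteq> 0" by (simp add: flat_exp_def)
  finally show ?thesis using that cf by blast
qed

text \<open>The modulus of a nonzero divergence attains its maximum on the compact support. Translating that
  point to the origin and dividing by the value there gives the normalisation.\<close>

lemma compact_field_divergence_peak:
  obtains \<Psi> :: "'a::euclidean_space \<Rightarrow> 'a"
  where "compact_field \<Psi>" "divergence \<Psi> 0 = 1" "\<And>x. \<bar>divergence \<Psi> x\<bar> \<le> 1"
proof -
  obtain \<Phi> :: "'a \<Rightarrow> 'a" and y where \<Phi>: "compact_field \<Phi>" and y: "divergence \<Phi> y \<noteq> 0"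
    using compact_field_nonzero_divergence by blast
  interpret compact_field \<Phi> by fact
  have yS: "y \<in> S" using y divergence_outside by blast
  have "continuous_on S (\<lambda>x. \<bar>divergence \<Phi> x\<bar>)"
    by (intro continuous_intros continuous_on_subset[OF continuous_divergence]) auto
  with continuous_attains_sup[of S "\<lambda>x. \<bar>divergence \<Phi> x\<bar>"] supp yS
  have "\<exists>p\<in>S. \<forall>x\<in>S. \<bar>divergence \<Phi> x\<bar> \<le> \<bar>divergence \<Phi> p\<bar>"
    unfolding compactly_supported_def by (metis empty_iff)
  then obtain p where p: "\<And>x. x \<in> S \<Longrightarrow> \<bar>divergence \<Phi> x\<bar> \<le> \<bar>divergence \<Phi> p\<bar>"
    by auto
  let ?d = "divergence \<Phi> p"
  have le: "\<bar>divergence \<Phi> x\<bar> \<le> \<bar>?d\<bar>" for x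
    using p divergence_outside[of x] by (cases "x \<in> S") auto
  have d: "?d \<noteq> 0" using le[of y] y by auto
  define \<Psi> where "\<Psi> = (\<lambda>x. (1 / ?d) *\<^sub>R \<Phi> (p + 1 *\<^sub>R x))"
  have "divergence \<Psi> x = divergence \<Phi> (p + x) / ?d" for x
    unfolding \<Psi>_def divergence_rescale by simp
  moreover have "compact_field \<Psi>"
    unfolding \<Psi>_def by (rule compact_field_rescale) simp
  ultimately show ?thesis
    using that[of \<Psi>] d le by (simp add: divide_le_eq)
qed

context compact_field begin

lemma integrable_of_continuous:
  fixes g :: "'a \<Rightarrow> real"
  assumes "continuous_on UNIV g" "\<And>x. x \<notin> S \<Longrightarrow> g x = 0"
  shows "integrable lborel g"
proof -
  have "compact S" using supp by (simp add: compactly_supported_def)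
  then have "set_integrable lborel S g"
    using continuous_on_subset[OF assms(1)] unfolding set_integrable_def
    by (intro borel_integrable_compact) auto
  moreover have "(\<lambda>x. indicator S x *\<^sub>R g x) = g"
    using assms(2) by (intro ext) (auto simp: indicator_def)
  ultimately show ?thesis unfolding set_integrable_def by simp
qed

text \<open>The integral of a function equals that of its translates, so the difference quotients in
  direction \<open>v\<close> have integral \<open>0\<close>. By the mean value theorem they are bounded by the supremum of
  the derivative, and they vanish outside a fixed ball; dominated convergence applies.\<close>

lemma integral_partial_derivative:
  "(\<integral>x. frechet_derivative \<Phi> (at x) v \<bullet> w \<partial>lborel) = 0"
proof -
  define g where "g x = \<Phi> x \<bullet> w" for x
  define D where "D x = frechet_derivative \<Phi> (at x) v \<bullet> w" for x
  define q where "q n x = (g (inverse (real (Suc n)) *\<^sub>R v + x) - g x) / inverse (real (Suc n))" for n x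
  have contg: "continuous_on UNIV g"
    unfolding g_def by (intro continuous_intros continuous)
  have contD: "continuous_on UNIV D"
    unfolding D_def by (intro continuous_intros continuous_derivative)
  have g0: "g x = 0" if "x \<notin> S" for x
    using outside[OF that] by (simp add: g_def)
  have D0: "D x = 0" if "x \<notin> S" for x
    using derivative_outside[OF that] by (simp add: D_def)
  obtain M where M: "M > 0" "\<And>x. \<bar>D x\<bar> \<le> M"
    using bounded_of_continuous[OF contD D0] by auto
  have "bounded S"
    using supp unfolding compactly_supported_def by (rule compact_imp_bounded)
  then obtain R where R: "\<And>x. x \<in> S \<Longrightarrow> norm x \<le> R"
    unfolding bounded_iff by blast
  have deriv: "((\<lambda>s. g (s *\<^sub>R v + x)) has_real_derivative D (s *\<^sub>R v + x)) (at s)" for x s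
  proof -
    let ?F = "frechet_derivative \<Phi> (at (s *\<^sub>R v + x))"
    have "((\<lambda>s. s *\<^sub>R v + x) has_derivative (\<lambda>h. h *\<^sub>R v)) (at s)"
      by (auto intro!: derivative_eq_intros)
    from has_derivative_inner_left[OF has_derivative_compose[OF this has_derivative], of w]
    have "((\<lambda>s. g (s *\<^sub>R v + x)) has_derivative (\<lambda>h. ?F (h *\<^sub>R v) \<bullet> w)) (at s)"
      by (simp only: g_def)
    moreover have "(\<lambda>h. ?F (h *\<^sub>R v) \<bullet> w) = (*) (D (s *\<^sub>R v + x))"
      using linear_cmul[OF has_derivative_linear[OF has_derivative]] by (intro ext) (simp add: D_def)
    ultimately show ?thesis
      by (simp only: has_field_derivative_def)
  qed
  have lim: "(\<lambda>n. q n x) \<longlonglongrightarrow> D x" for x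
  proof -
    have "((\<lambda>h. (g (h *\<^sub>R v + x) - g x) / h) \<longlongrightarrow> D x) (at 0)"
      using deriv[of x 0] unfolding DERIV_def by simp
    moreover have "filterlim (\<lambda>n. inverse (real (Suc n))) (at 0) sequentially"
      by (rule filterlim_atI[OF LIMSEQ_inverse_real_of_nat]) simp
    ultimately show ?thesis
      unfolding q_def by (rule filterlim_compose)
  qed
  have bound: "norm (q n x) \<le> M * indicator (cball 0 (R + norm v)) x" for n x
  proof (cases "x \<in> cball 0 (R + norm v)")
    case True
    have "\<exists>z. 0 < z \<and> z < inverse (real (Suc n)) \<and>
      g (inverse (real (Suc n)) *\<^sub>R v + x) - g (0 *\<^sub>R v + x)
        = (inverse (real (Suc n)) - 0) * D (z *\<^sub>R v + x)"
      by (rule MVT2) (use deriv in auto)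
    then obtain z where "q n x = D (z *\<^sub>R v + x)"
      by (auto simp: q_def)
    with M True show ?thesis by simp
  next
    case False
    then have "norm x > R + norm v" by simp
    moreover have "norm (inverse (real (Suc n)) *\<^sub>R v) \<le> norm v"
      by (simp add: divide_simps distrib_left)
    ultimately have "norm (inverse (real (Suc n)) *\<^sub>R v + x) > R" "norm x > R"
      using norm_triangle_ineq4[of "inverse (real (Suc n)) *\<^sub>R v + x" "inverse (real (Suc n)) *\<^sub>R v"]
        norm_ge_zero[of v] unfolding add_diff_cancel_left' by linarith+
    then have "inverse (real (Suc n)) *\<^sub>R v + x \<notin> S" "x \<notin> S"
      using R leD by blast+
    then have "g (inverse (real (Suc n)) *\<^sub>R v + x) = 0" "g x = 0"
      using g0 by blast+
    then show ?thesis using False by (simp add: q_def)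
  qed
  have int_g: "integrable lborel g"
    by (rule integrable_of_continuous[OF contg g0])
  have shift: "integrable lborel (\<lambda>x. g (c + x))" "(\<integral>x. g (c + x) \<partial>lborel) = (\<integral>x. g x \<partial>lborel)" for c
    using int_g integrable_distr_eq[of "(+) c" lborel borel g] integral_distr[of "(+) c" lborel borel g]
    by (auto simp: lborel_distr_plus)
  have "(\<lambda>n. \<integral>x. q n x \<partial>lborel) \<longlonglongrightarrow> (\<integral>x. D x \<partial>lborel)"
  proof (rule integral_dominated_convergence)
    show "integrable lborel (\<lambda>x. M * indicator (cball 0 (R + norm v)) x)"
      by (intro integrable_mult_right integrable_real_indicator emeasure_bounded_finite bounded_cball) simp
    show "D \<in> borel_measurable lborel"
      using contD by (simp add: borel_measurable_continuous_onI)
    show "q n \<in> borel_measurable lborel" for n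
      unfolding q_def using int_g shift(1) by (auto intro!: borel_measurable_divide borel_measurable_diff)
  qed (use lim bound in auto)
  moreover have "(\<integral>x. q n x \<partial>lborel) = 0" for n
    unfolding q_def using int_g shift by simp
  ultimately have "(\<integral>x. D x \<partial>lborel) = 0"
    by (simp add: LIMSEQ_const_iff)
  then show ?thesis by (simp add: D_def)
qed

lemma integral_divergence: "(\<integral>x. divergence \<Phi> x \<partial>lebesgue) = 0"
proof -
  have "integrable lborel (\<lambda>x. frechet_derivative \<Phi> (at x) b \<bullet> b)" for b
    by (intro integrable_of_continuous continuous_intros continuous_derivative)
      (simp add: derivative_outside)
  then have "(\<integral>x. divergence \<Phi> x \<partial>lborel) = 0"
    unfolding divergence_def by (simp add: integral_partial_derivative)
  moreover have "divergence \<Phi> \<in> borel_measurable lborel"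
    using continuous_divergence by (simp add: borel_measurable_continuous_onI)
  ultimately show ?thesis by (simp add: integral_completion)
qed

lemma divergence_measurable: "divergence \<Phi> \<in> borel_measurable lebesgue"
  by (rule measurable_completion)
    (use continuous_divergence in \<open>simp add: borel_measurable_continuous_onI\<close>)

lemma integrable_mult_divergence:
  fixes f :: "'a \<Rightarrow> real"
  assumes "set_integrable lebesgue S f"
  shows "integrable lebesgue (\<lambda>x. f x * divergence \<Phi> x)"
proof -
  obtain M where M: "\<And>x. \<bar>divergence \<Phi> x\<bar> \<le> M"
    using bounded_of_continuous[OF continuous_divergence divergence_outside] by auto
  have int: "integrable lebesgue (\<lambda>x. indicator S x * f x)"
    using assms by (simp add: set_integrable_def)
  have "integrable lebesgue (\<lambda>x. indicator S x * f x * divergence \<Phi> x)"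
  proof (rule Bochner_Integration.integrable_bound)
    show "integrable lebesgue (\<lambda>x. M * \<bar>indicator S x * f x\<bar>)"
      using int by (intro integrable_mult_right integrable_abs)
    show "(\<lambda>x. indicator S x * f x * divergence \<Phi> x) \<in> borel_measurable lebesgue"
      using int by (intro borel_measurable_times divergence_measurable borel_measurable_integrable)
    show "AE x in lebesgue. norm (indicator S x * f x * divergence \<Phi> x)
        \<le> norm (M * \<bar>indicator S x * f x\<bar>)"
    proof (intro AE_I2)
      fix x
      have "\<bar>indicator S x * f x\<bar> * \<bar>divergence \<Phi> x\<bar> \<le> \<bar>indicator S x * f x\<bar> * \<bar>M\<bar>"
        using M[of x] by (intro mult_left_mono) auto
      then show "norm (indicator S x * f x * divergence \<Phi> x) \<le> norm (M * \<bar>indicator S x * f x\<bar>)"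
        by (simp only: real_norm_def abs_mult abs_abs mult.commute[of "\<bar>M\<bar>"])
    qed
  qed
  moreover have "(\<lambda>x. indicator S x * f x * divergence \<Phi> x) = (\<lambda>x. f x * divergence \<Phi> x)"
    using divergence_outside by (intro ext) (auto simp: indicator_def)
  ultimately show ?thesis by simp
qed

end

lemma test_fields_iff: "\<Phi> \<in> test_fields \<longleftrightarrow> compact_field \<Phi> \<and> (\<forall>x. norm (\<Phi> x) \<le> 1)"
  by (auto simp: test_fields_def compact_field_def)

lemma total_variation_const: "total_variation (\<lambda>_::'a::euclidean_space. c) = 0"
proof -
  have "ennreal (\<integral>x. c * divergence \<Phi> x \<partial>lebesgue) \<le> 0" if "\<Phi> \<in> test_fields" for \<Phi> :: "'a \<Rightarrow> 'a"
    using that compact_field.integral_divergence[of \<Phi>] by (simp add: test_fields_iff)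
  then have "total_variation (\<lambda>_::'a. c) \<le> 0"
    unfolding total_variation_def by (rule SUP_least)
  then show ?thesis by simp
qed

section \<open>The K-functional of an indicator function\<close>

lemma L1_loc_indicator:
  fixes A :: "'a::euclidean_space set"
  assumes "A \<in> sets lebesgue" shows "indicator A \<in> L1_loc"
  unfolding L1_loc_def set_integrable_def
proof (intro CollectI allI impI)
  fix C :: "'a set" assume "compact C"
  then have "C \<inter> A \<in> sets lebesgue" "emeasure lebesgue (C \<inter> A) < \<infinity>"
    using assms lmeasurable_compact[of C] fmeasurable_Int_fmeasurable[of C lebesgue A]
    by (auto simp: fmeasurable_def)
  then have "integrable lebesgue (indicator (C \<inter> A) :: 'a \<Rightarrow> real)"
    by (rule integrable_real_indicator)
  then show "integrable lebesgue (\<lambda>x. indicator C x *\<^sub>R indicator A x :: real)"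
    by (simp add: indicator_inter_arith[abs_def])
qed

lemma const_BV_dot: "(\<lambda>_::'a::euclidean_space. c) \<in> BV_dot"
proof -
  have "set_integrable lebesgue C (\<lambda>_::'a. c)" if "compact C" for C :: "'a set"
    using that lmeasurable_compact[of C]
    by (auto simp: set_integrable_def fmeasurable_def less_top[symmetric])
  then show ?thesis
    by (simp add: BV_dot_def L1_loc_def total_variation_const)
qed

lemma K_functional_le:
  assumes "integrable lebesgue f1" "f2 \<in> BV_dot" "\<And>x. f x = f1 x + f2 x"
  shows "K_functional t f \<le> (\<integral>\<^sup>+x. ennreal \<bar>f1 x\<bar> \<partial>lebesgue) + ennreal t * total_variation f2"
proof -
  have "(f1, f2) \<in> {(f1, f2). integrable lebesgue f1 \<and> f2 \<in> BV_dot \<and> (AE x in lebesgue. f x = f1 x + f2 x)}"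
    using assms by simp
  from INF_lower[OF this, of "\<lambda>(f1, f2).
      (\<integral>\<^sup>+x. ennreal \<bar>f1 x\<bar> \<partial>lebesgue) + ennreal t * total_variation f2"]
  show ?thesis
    unfolding K_functional_def by (simp only: prod.case)
qed

lemma K_functional_indicator_le_measure:
  fixes A :: "'a::euclidean_space set"
  assumes "A \<in> sets lebesgue"
  shows "K_functional t (indicator A) \<le> emeasure lebesgue A"
proof (cases "emeasure lebesgue A < \<infinity>")
  case True
  then show ?thesis
    using K_functional_le[OF integrable_real_indicator[OF assms] const_BV_dot[of 0], of "indicator A" t] assms
    by (simp add: total_variation_const ennreal_indicator)
qed (simp add: less_top[symmetric])

lemma K_functional_indicator_le_perimeter:
  assumes "finite_perimeter A"
  shows "K_functional t (indicator A) \<le> ennreal t * perimeter A"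
proof -
  have "indicator A \<in> BV_dot"
    using assms L1_loc_indicator[of A] unfolding BV_dot_def finite_perimeter_def perimeter_def by blast
  from K_functional_le[of "\<lambda>_. 0", OF _ this, of "indicator A" t] show ?thesis
    by (simp add: perimeter_def)
qed

text \<open>The decomposition is \<open>\<chi> = - \<chi>' + 1\<close>, where \<open>\<chi>'\<close> is the indicator function of the complement.\<close>

lemma K_functional_indicator_le_measure_Compl:
  fixes A :: "'a::euclidean_space set"
  assumes "A \<in> sets lebesgue"
  shows "K_functional t (indicator A) \<le> emeasure lebesgue (- A)"
proof (cases "emeasure lebesgue (- A) < \<infinity>")
  case True
  have A: "- A \<in> sets lebesgue"
    using sets.compl_sets[OF assms] by (simp add: Compl_eq_Diff_UNIV)
  have "K_functional t (indicator A) \<le>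
      (\<integral>\<^sup>+x. ennreal \<bar>- indicator (- A) x\<bar> \<partial>lebesgue) + ennreal t * total_variation (\<lambda>_::'a. 1)"
  proof (rule K_functional_le[OF _ const_BV_dot])
    show "integrable lebesgue (\<lambda>x. - indicator (- A) x :: real)"
      by (intro integrable_minus integrable_real_indicator A True)
  qed (simp split: split_indicator)
  then show ?thesis
    using A by (simp add: total_variation_const ennreal_indicator)
qed (simp add: less_top[symmetric])

text \<open>Split the flux along \<open>f = f1 + f2\<close>. The part of \<open>f1\<close> is controlled by the bound on the divergence,
  the part of \<open>f2\<close> by its variation, tested with \<open>\<Psi> / t\<close>.\<close>

lemma K_functional_ge_flux:
  fixes f :: "'a::euclidean_space \<Rightarrow> real"
  assumes f: "f \<in> borel_measurable lebesgue"
    and \<Psi>: "compact_field \<Psi>" "\<And>x. norm (\<Psi> x) \<le> t" "\<And>x. \<bar>divergence \<Psi> x\<bar> \<le> 1"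
    and t: "t > 0"
  shows "ennreal (\<integral>x. f x * divergence \<Psi> x \<partial>lebesgue) \<le> K_functional t f"
  unfolding K_functional_def
proof (rule INF_greatest, clarify)
  fix f1 f2 :: "'a \<Rightarrow> real"
  assume f1: "integrable lebesgue f1" and f2: "f2 \<in> BV_dot" and ae: "AE x in lebesgue. f x = f1 x + f2 x"
  interpret compact_field \<Psi> by fact
  define \<Phi> where "\<Phi> = (\<lambda>x. (1 / t) *\<^sub>R \<Psi> (0 + 1 *\<^sub>R x))"
  have \<Phi>: "\<Phi> \<in> test_fields"
    using compact_field_rescale[of 1 "1 / t" 0] \<Psi>(2) t by (auto simp: test_fields_iff \<Phi>_def divide_le_eq)
  have div: "divergence \<Psi> x = t * divergence \<Phi> x" for x
    using t divergence_rescale[of "1 / t" 0 1] by (simp add: \<Phi>_def)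
  have S: "compact S" using supp by (simp add: compactly_supported_def)
  then have "S \<in> sets lebesgue" using lmeasurable_compact by blast
  then have int1: "integrable lebesgue (\<lambda>x. f1 x * divergence \<Psi> x)"
    by (intro integrable_mult_divergence) (simp only: set_integrable_def integrable_mult_indicator f1)
  have int2: "integrable lebesgue (\<lambda>x. f2 x * divergence \<Psi> x)"
    using f2 S by (intro integrable_mult_divergence) (auto simp: BV_dot_def L1_loc_def)
  have "(\<integral>x. f x * divergence \<Psi> x \<partial>lebesgue)
      = (\<integral>x. f1 x * divergence \<Psi> x + f2 x * divergence \<Psi> x \<partial>lebesgue)"
    using ae f divergence_measurable int1 int2
    by (intro integral_cong_AE) (auto simp: algebra_simps)
  also have "\<dots> = (\<integral>x. f1 x * divergence \<Psi> x \<partial>lebesgue) + t * (\<integral>x. f2 x * divergence \<Phi> x \<partial>lebesgue)"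
    (is "_ = ?I1 + t * ?I2")
    using int1 int2 by (simp add: div mult.left_commute[of _ t])
  also have "\<dots> \<le> (\<integral>x. \<bar>f1 x\<bar> \<partial>lebesgue) + max 0 (t * ?I2)"
  proof (intro add_mono)
    show "?I1 \<le> (\<integral>x. \<bar>f1 x\<bar> \<partial>lebesgue)"
    proof (rule integral_mono[OF int1])
      show "f1 x * divergence \<Psi> x \<le> \<bar>f1 x\<bar>" for x
      proof -
        have "f1 x * divergence \<Psi> x \<le> \<bar>f1 x\<bar> * \<bar>divergence \<Psi> x\<bar>"
          by (metis abs_ge_self abs_mult)
        also have "\<dots> \<le> \<bar>f1 x\<bar> * 1" by (intro mult_left_mono \<Psi>) auto
        finally show ?thesis by simp
      qed
    qed (use f1 in auto)
  qed auto
  finally have "ennreal (\<integral>x. f x * divergence \<Psi> x \<partial>lebesgue)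
      \<le> ennreal ((\<integral>x. \<bar>f1 x\<bar> \<partial>lebesgue) + max 0 (t * ?I2))"
    by (rule ennreal_leI)
  also have "\<dots> = ennreal (\<integral>x. \<bar>f1 x\<bar> \<partial>lebesgue) + ennreal (max 0 (t * ?I2))"
    by (rule ennreal_plus) auto
  also have "ennreal (\<integral>x. \<bar>f1 x\<bar> \<partial>lebesgue) = (\<integral>\<^sup>+x. ennreal \<bar>f1 x\<bar> \<partial>lebesgue)"
    using f1 by (intro nn_integral_eq_integral[symmetric]) auto
  also have "ennreal (max 0 (t * ?I2)) = ennreal t * ennreal ?I2"
    using t by (simp add: ennreal_mult'[symmetric] max_def ennreal_neg)
  also have "ennreal t * ennreal ?I2 \<le> ennreal t * total_variation f2"
    unfolding total_variation_def by (intro mult_left_mono SUP_upper \<Phi>) auto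
  finally show "ennreal (\<integral>x. f x * divergence \<Psi> x \<partial>lebesgue)
      \<le> (\<integral>\<^sup>+x. ennreal \<bar>f1 x\<bar> \<partial>lebesgue) + ennreal t * total_variation f2"
    by (simp add: add_left_mono)
qed

text \<open>Dilate a field whose divergence peaks at the origin with value \<open>1\<close>. The divergences are dominated
  by \<open>1\<close> and tend to \<open>1\<close> pointwise, so the flux through \<open>A\<close> tends to the measure. The chosen
  dilation is admissible for all \<open>t\<close> above the supremum of its norm.\<close>

lemma K_functional_indicator_ge_near_infinity:
  fixes A :: "'a::euclidean_space set"
  assumes A: "A \<in> sets lebesgue" "emeasure lebesgue A < \<infinity>" and c: "c < measure lebesgue A"
  obtains T where "T > 0" "\<And>t. T \<le> t \<Longrightarrow> ennreal c \<le> K_functional t (indicator A)"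
proof -
  obtain \<Psi> :: "'a \<Rightarrow> 'a" where \<Psi>: "compact_field \<Psi>" "divergence \<Psi> 0 = 1"
    "\<And>x. \<bar>divergence \<Psi> x\<bar> \<le> 1"
    using compact_field_divergence_peak by blast
  interpret compact_field \<Psi> by fact
  obtain M where M: "M > 0" "\<And>x. norm (\<Psi> x) \<le> M"
    using bounded_of_continuous[OF continuous outside] by blast
  define \<Psi>' where "\<Psi>' n = (\<lambda>x. real (Suc n) *\<^sub>R \<Psi> (0 + inverse (real (Suc n)) *\<^sub>R x))" for n
  have div: "divergence (\<Psi>' n) x = divergence \<Psi> (inverse (real (Suc n)) *\<^sub>R x)" for n x
    unfolding \<Psi>'_def divergence_rescale by (simp del: of_nat_Suc)
  have field: "compact_field (\<Psi>' n)" for n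
    unfolding \<Psi>'_def by (intro compact_field_rescale) simp
  have "(\<lambda>n. \<integral>x. indicator A x * divergence (\<Psi>' n) x \<partial>lebesgue) \<longlonglongrightarrow> (\<integral>x. indicator A x \<partial>lebesgue)"
  proof (rule integral_dominated_convergence)
    show "integrable lebesgue (indicator A :: 'a \<Rightarrow> real)"
      by (intro integrable_real_indicator A)
    show "indicator A \<in> borel_measurable lebesgue"
      using A by (intro borel_measurable_indicator)
    show "(\<lambda>x. indicator A x * divergence (\<Psi>' n) x) \<in> borel_measurable lebesgue" for n
      using A by (intro borel_measurable_times borel_measurable_indicator
          compact_field.divergence_measurable[OF field])
    show "AE x in lebesgue. (\<lambda>n. indicator A x * divergence (\<Psi>' n) x) \<longlonglongrightarrow> indicator A x"
    proof (intro AE_I2)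
      fix x :: 'a
      have "(\<lambda>n. inverse (real (Suc n)) *\<^sub>R x) \<longlonglongrightarrow> 0 *\<^sub>R x"
        by (rule tendsto_scaleR[OF LIMSEQ_inverse_real_of_nat tendsto_const])
      moreover have "isCont (divergence \<Psi>) (0 *\<^sub>R x)"
        using continuous_divergence by (simp add: continuous_on_eq_continuous_at)
      ultimately have "(\<lambda>n. divergence (\<Psi>' n) x) \<longlonglongrightarrow> divergence \<Psi> (0 *\<^sub>R x)"
        unfolding div by (rule isCont_tendsto_compose[rotated])
      then have "(\<lambda>n. indicator A x * divergence (\<Psi>' n) x)
          \<longlonglongrightarrow> indicator A x * divergence \<Psi> (0 *\<^sub>R x)"
        by (rule tendsto_mult_left)
      then show "(\<lambda>n. indicator A x * divergence (\<Psi>' n) x) \<longlonglongrightarrow> indicator A x"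
        by (simp only: scaleR_zero_left \<Psi>(2) mult_1_right)
    qed
    show "AE x in lebesgue. norm (indicator A x * divergence (\<Psi>' n) x) \<le> indicator A x" for n
      using \<Psi>(3) by (intro AE_I2) (simp add: div split: split_indicator)
  qed
  moreover have "(\<integral>x. indicator A x \<partial>lebesgue) = measure lebesgue A"
    by simp
  ultimately have "\<forall>\<^sub>F n in sequentially. c < (\<integral>x. indicator A x * divergence (\<Psi>' n) x \<partial>lebesgue)"
    using c by (simp only: order_tendstoD)
  then obtain n where n: "c < (\<integral>x. indicator A x * divergence (\<Psi>' n) x \<partial>lebesgue)"
    using eventually_happens'[OF sequentially_bot] by blast
  show thesis
  proof
    show "real (Suc n) * M > 0" using M by simp
    fix t assume t: "real (Suc n) * M \<le> t"
    have "norm (\<Psi>' n x) \<le> t" for x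
    proof -
      have "norm (\<Psi>' n x) \<le> real (Suc n) * M"
        unfolding \<Psi>'_def norm_scaleR using M by (intro mult_mono) auto
      then show ?thesis using t by simp
    qed
    then have "ennreal (\<integral>x. indicator A x * divergence (\<Psi>' n) x \<partial>lebesgue) \<le> K_functional t (indicator A)"
      using A \<Psi>(3) t \<open>real (Suc n) * M > 0\<close> field
      by (intro K_functional_ge_flux borel_measurable_indicator) (auto simp: div)
    then show "ennreal c \<le> K_functional t (indicator A)"
      using n by (meson ennreal_leI less_imp_le order_trans)
  qed
qed

text \<open>A test field \<open>\<Phi>\<close> with flux above \<open>c\<close> may be multiplied by \<open>t\<close> as long as \<open>t |div \<Phi>| \<le> 1\<close>.\<close>

lemma K_functional_indicator_ge_near_0:
  fixes A :: "'a::euclidean_space set"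
  assumes A: "A \<in> sets lebesgue" and c: "ennreal c < perimeter A"
  obtains s where "s > 0" "\<And>t. 0 < t \<Longrightarrow> t \<le> s \<Longrightarrow> ennreal (t * c) \<le> K_functional t (indicator A)"
proof -
  obtain \<Phi> :: "'a \<Rightarrow> 'a" where \<Phi>: "\<Phi> \<in> test_fields"
    and c': "ennreal c < ennreal (\<integral>x. indicator A x * divergence \<Phi> x \<partial>lebesgue)" (is "_ < ennreal ?I")
    using c unfolding perimeter_def total_variation_def by (auto simp: less_SUP_iff)
  interpret compact_field \<Phi> using \<Phi> by (simp add: test_fields_iff)
  obtain M where M: "M > 0" "\<And>x. norm (divergence \<Phi> x) \<le> M"
    using bounded_of_continuous[OF continuous_divergence divergence_outside] by blast
  show thesis
  proof
    show "1 / M > 0" using M by simp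
    fix t assume t: "0 < t" "t \<le> 1 / M"
    define \<Psi> where "\<Psi> = (\<lambda>x. t *\<^sub>R \<Phi> (0 + 1 *\<^sub>R x))"
    have div: "divergence \<Psi> x = t * divergence \<Phi> x" for x
      unfolding \<Psi>_def divergence_rescale by simp
    have "\<bar>divergence \<Psi> x\<bar> \<le> 1" for x
    proof -
      have "\<bar>divergence \<Psi> x\<bar> \<le> (1 / M) * M"
        unfolding div abs_mult using M(2)[of x] t M(1) by (intro mult_mono) auto
      then show ?thesis using M by simp
    qed
    moreover have "norm (\<Psi> x) \<le> t" for x
      using \<Phi> t mult_left_mono[of "norm (\<Phi> x)" 1 t] by (simp add: \<Psi>_def test_fields_iff)
    moreover have "compact_field \<Psi>"
      unfolding \<Psi>_def by (rule compact_field_rescale) simp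
    ultimately have "ennreal (\<integral>x. indicator A x * divergence \<Psi> x \<partial>lebesgue) \<le> K_functional t (indicator A)"
      using A t by (intro K_functional_ge_flux borel_measurable_indicator)
    moreover have "(\<integral>x. indicator A x * divergence \<Psi> x \<partial>lebesgue) = t * ?I"
      by (simp add: div mult.left_commute[of _ t])
    moreover have "c \<le> ?I"
      using c' by (metis ennreal_leI leD le_cases)
    then have "ennreal (t * c) \<le> ennreal (t * ?I)"
      using t by (intro ennreal_leI mult_left_mono) auto
    ultimately show "ennreal (t * c) \<le> K_functional t (indicator A)"
      by simp
  qed
qed

section \<open>The weighted integral over the scales\<close>

text \<open>The two bounds on the K-functional cross at \<open>s = m / P\<close>. Using the better one on each side, the
  integrals contribute \<open>\<alpha>\<close> and \<open>1 - \<alpha>\<close> times the right-hand side, respectively.\<close>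

lemma fractional_perimeter_le:
  assumes \<alpha>: "0 < \<alpha>" "\<alpha> < 1" and nonneg: "0 \<le> m" "0 \<le> P"
    and K_m: "\<And>t. t > 0 \<Longrightarrow> K_functional t (indicator A) \<le> ennreal m"
    and K_P: "\<And>t. t > 0 \<Longrightarrow> K_functional t (indicator A) \<le> ennreal (t * P)"
  shows "fractional_perimeter \<alpha> A \<le> ennreal (m powr (1 - \<alpha>) * P powr \<alpha>)"
proof (cases "m = 0 \<or> P = 0")
  case True
  then have "K_functional t (indicator A) = 0" if "t > 0" for t
    using K_m[OF that] K_P[OF that] by auto
  then have "fractional_perimeter \<alpha> A
      = ennreal (\<alpha> * (1 - \<alpha>)) * (\<integral>\<^sup>+t. 0 \<partial>(lborel :: real measure))"
    unfolding fractional_perimeter_def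
    by (intro arg_cong2[where f = "(*)"] nn_integral_cong refl) (simp split: split_indicator)
  then show ?thesis by simp
next
  case False
  then have pos: "m > 0" "P > 0" using nonneg by auto
  define s where "s = m / P"
  have s: "s > 0" using pos by (simp add: s_def)
  have K_bound: "ennreal (t powr - \<alpha>) * K_functional t (indicator A) * ennreal (1 / t) * indicator {0<..} t
      \<le> ennreal (P * t powr - \<alpha>) * indicator {0..s} t
        + ennreal (m * t powr (- \<alpha> - 1)) * indicator {s..} t" for t
  proof (cases "t > 0")
    case True
    show ?thesis
    proof (cases "t \<le> s")
      case le: True
      have "ennreal (t powr - \<alpha>) * K_functional t (indicator A) * ennreal (1 / t)
          \<le> ennreal (t powr - \<alpha>) * ennreal (t * P) * ennreal (1 / t)"
        by (intro mult_right_mono mult_left_mono K_P[OF True]) auto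
      also have "\<dots> = ennreal (P * t powr - \<alpha>)"
        using True pos by (simp add: ennreal_mult'[symmetric])
      finally show ?thesis using True le by (simp add: add_increasing2)
    next
      case gt: False
      have "ennreal (t powr - \<alpha>) * K_functional t (indicator A) * ennreal (1 / t)
          \<le> ennreal (t powr - \<alpha>) * ennreal m * ennreal (1 / t)"
        by (intro mult_right_mono mult_left_mono K_m[OF True]) auto
      also have "\<dots> = ennreal (m * t powr (- \<alpha> - 1))"
        using True pos by (simp add: ennreal_mult'[symmetric] powr_diff)
      finally show ?thesis using True gt by simp
    qed
  qed simp
  have I1: "(\<integral>\<^sup>+t. ennreal (P * t powr - \<alpha>) * indicator {0..s} t \<partial>lborel)
      = ennreal (P * (s powr (1 - \<alpha>) / (1 - \<alpha>)))"
    using has_integral_mult_right[OF has_integral_powr_from_0[of "- \<alpha>" s], of P] \<alpha> s pos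
    by (intro nn_integral_has_integral_lebesgue') auto
  have I2: "(\<integral>\<^sup>+t. ennreal (m * t powr (- \<alpha> - 1)) * indicator {s..} t \<partial>lborel)
      = ennreal (m * (s powr - \<alpha> / \<alpha>))"
    using has_integral_mult_right[OF has_integral_powr_to_inf[of "- \<alpha> - 1" s], of m] \<alpha> s pos
    by (intro nn_integral_has_integral_lebesgue') auto
  have "fractional_perimeter \<alpha> A \<le> ennreal (\<alpha> * (1 - \<alpha>)) *
     (\<integral>\<^sup>+t. ennreal (P * t powr - \<alpha>) * indicator {0..s} t
        + ennreal (m * t powr (- \<alpha> - 1)) * indicator {s..} t \<partial>lborel)"
    unfolding fractional_perimeter_def
    by (intro mult_left_mono nn_integral_mono K_bound) auto
  also have "\<dots> = ennreal (\<alpha> * (1 - \<alpha>)) *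
     ennreal (P * (s powr (1 - \<alpha>) / (1 - \<alpha>)) + m * (s powr - \<alpha> / \<alpha>))"
    using \<alpha> pos by (subst nn_integral_add) (simp_all add: I1 I2 ennreal_plus)
  also have "\<dots> = ennreal (\<alpha> * (1 - \<alpha>) * (P * (s powr (1 - \<alpha>) / (1 - \<alpha>)) + m * (s powr - \<alpha> / \<alpha>)))"
    using \<alpha> by (intro ennreal_mult'[symmetric]) simp
  also have "\<alpha> * (1 - \<alpha>) * (P * (s powr (1 - \<alpha>) / (1 - \<alpha>)) + m * (s powr - \<alpha> / \<alpha>))
      = m powr (1 - \<alpha>) * P powr \<alpha>"
  proof -
    have "s powr (1 - \<alpha>) = s * s powr - \<alpha>"
      using s powr_add[of s 1 "- \<alpha>"] by simp
    then have "P * s powr (1 - \<alpha>) = m * s powr - \<alpha>"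
      using pos by (simp add: s_def)
    moreover have "m * s powr - \<alpha> = m powr (1 - \<alpha>) * P powr \<alpha>"
      using pos by (simp add: s_def powr_divide powr_minus powr_diff field_simps)
    moreover have "\<alpha> * (1 - \<alpha>) * (P * (s powr (1 - \<alpha>) / (1 - \<alpha>)) + m * (s powr - \<alpha> / \<alpha>))
        = \<alpha> * (P * s powr (1 - \<alpha>)) + (1 - \<alpha>) * (m * s powr - \<alpha>)"
      using \<alpha> by (simp add: field_simps)
    ultimately show ?thesis by (simp add: algebra_simps)
  qed
  finally show ?thesis .
qed

text \<open>The part of the integral over \<open>{0..s}\<close> already yields a bound that tends to \<open>c\<close> as \<open>\<alpha>\<close> tends to
  \<open>1\<close>, whatever \<open>s\<close> is.\<close>

lemma fractional_perimeter_ge_near_0: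
  assumes \<alpha>: "0 < \<alpha>" "\<alpha> < 1" and c: "0 \<le> c" and s: "0 < s"
    and K: "\<And>t. 0 < t \<Longrightarrow> t \<le> s \<Longrightarrow> ennreal (t * c) \<le> K_functional t (indicator A)"
  shows "ennreal (\<alpha> * c * s powr (1 - \<alpha>)) \<le> fractional_perimeter \<alpha> A"
proof -
  have "ennreal (\<alpha> * c * s powr (1 - \<alpha>)) = ennreal (\<alpha> * (1 - \<alpha>)) * ennreal (c * (s powr (1 - \<alpha>) / (1 - \<alpha>)))"
    using \<alpha> by (simp add: ennreal_mult'[symmetric] mult.assoc)
  also have "ennreal (c * (s powr (1 - \<alpha>) / (1 - \<alpha>))) =
      (\<integral>\<^sup>+t. ennreal (c * t powr - \<alpha>) * indicator {0..s} t \<partial>lborel)"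
    using has_integral_mult_right[OF has_integral_powr_from_0[of "- \<alpha>" s], of c] \<alpha> s c
    by (intro nn_integral_has_integral_lebesgue'[symmetric]) auto
  also have "ennreal (\<alpha> * (1 - \<alpha>)) * \<dots> \<le> fractional_perimeter \<alpha> A"
    unfolding fractional_perimeter_def
  proof (intro mult_left_mono nn_integral_mono)
    fix t :: real
    show "ennreal (c * t powr - \<alpha>) * indicator {0..s} t
      \<le> ennreal (t powr - \<alpha>) * K_functional t (indicator A) * ennreal (1 / t) * indicator {0<..} t"
    proof (cases "0 < t \<and> t \<le> s")
      case True
      have "ennreal (c * t powr - \<alpha>) = ennreal (t powr - \<alpha>) * ennreal (t * c) * ennreal (1 / t)"
        using True c by (simp add: ennreal_mult'[symmetric])
      also have "\<dots> \<le> ennreal (t powr - \<alpha>) * K_functional t (indicator A) * ennreal (1 / t)"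
        using True by (intro mult_right_mono mult_left_mono K) auto
      finally show ?thesis using True by simp
    next
      case False
      then have "t = 0 \<or> t \<notin> {0..s}" by auto
      then show ?thesis by auto
    qed
  qed auto
  finally show ?thesis .
qed

text \<open>Likewise, the part over \<open>{s..}\<close> yields a bound that tends to \<open>c\<close> as \<open>\<alpha>\<close> tends to \<open>0\<close>.\<close>

lemma fractional_perimeter_ge_near_infinity:
  assumes \<alpha>: "0 < \<alpha>" "\<alpha> < 1" and c: "0 \<le> c" and s: "0 < s"
    and K: "\<And>t. s \<le> t \<Longrightarrow> ennreal c \<le> K_functional t (indicator A)"
  shows "ennreal ((1 - \<alpha>) * c * s powr - \<alpha>) \<le> fractional_perimeter \<alpha> A"
proof -
  have "ennreal ((1 - \<alpha>) * c * s powr - \<alpha>) = ennreal (\<alpha> * (1 - \<alpha>)) * ennreal (c * (s powr - \<alpha> / \<alpha>))"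
    using \<alpha> by (simp add: ennreal_mult'[symmetric] mult.assoc)
  also have "ennreal (c * (s powr - \<alpha> / \<alpha>)) =
      (\<integral>\<^sup>+t. ennreal (c * t powr (- \<alpha> - 1)) * indicator {s..} t \<partial>lborel)"
    using has_integral_mult_right[OF has_integral_powr_to_inf[of "- \<alpha> - 1" s], of c] \<alpha> s c
    by (intro nn_integral_has_integral_lebesgue'[symmetric]) auto
  also have "ennreal (\<alpha> * (1 - \<alpha>)) * \<dots> \<le> fractional_perimeter \<alpha> A"
    unfolding fractional_perimeter_def
  proof (intro mult_left_mono nn_integral_mono)
    fix t :: real
    show "ennreal (c * t powr (- \<alpha> - 1)) * indicator {s..} t
      \<le> ennreal (t powr - \<alpha>) * K_functional t (indicator A) * ennreal (1 / t) * indicator {0<..} t"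
    proof (cases "s \<le> t")
      case True
      then have "t > 0" using s by simp
      then have "ennreal (c * t powr (- \<alpha> - 1)) = ennreal (t powr - \<alpha>) * ennreal c * ennreal (1 / t)"
        using c by (simp add: ennreal_mult'[symmetric] powr_diff)
      also have "\<dots> \<le> ennreal (t powr - \<alpha>) * K_functional t (indicator A) * ennreal (1 / t)"
        using True by (intro mult_right_mono mult_left_mono K) auto
      finally show ?thesis using True \<open>t > 0\<close> by simp
    qed simp
  qed auto
  finally show ?thesis .
qed

section \<open>The limits\<close>

text \<open>The limits below come with one upper bound but with a separate lower bound for each \<open>c < L\<close>;
  only nonnegative \<open>c\<close> matter for values in \<open>[0, \<infinity>]\<close>.\<close>

lemma tendsto_ennreal_sandwich:
  fixes F :: "real \<Rightarrow> ennreal"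
  assumes upper: "\<forall>\<^sub>F \<alpha> in G. F \<alpha> \<le> ennreal (u \<alpha>)" "(u \<longlongrightarrow> L) G"
    and lower: "\<And>c. 0 \<le> c \<Longrightarrow> c < L \<Longrightarrow>
      \<exists>l. (\<forall>\<^sub>F \<alpha> in G. ennreal (l \<alpha>) \<le> F \<alpha>) \<and> (l \<longlongrightarrow> c) G"
  shows "(F \<longlongrightarrow> ennreal L) G"
proof (rule order_tendstoI)
  fix a assume "a < ennreal L"
  then obtain b where b: "a < b" "b < ennreal L" using dense by blast
  then obtain c where c: "b = ennreal c" "0 \<le> c" by (cases b) auto
  with b have "c < L" by (metis ennreal_leI leD le_less_linear)
  then obtain l where l: "\<forall>\<^sub>F \<alpha> in G. ennreal (l \<alpha>) \<le> F \<alpha>" "(l \<longlongrightarrow> c) G"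
    using lower c by blast
  have "((\<lambda>\<alpha>. ennreal (l \<alpha>)) \<longlongrightarrow> ennreal c) G"
    by (intro tendsto_ennrealI l)
  then have "\<forall>\<^sub>F \<alpha> in G. a < ennreal (l \<alpha>)"
    using b c by (auto dest: order_tendstoD)
  with l(1) show "\<forall>\<^sub>F \<alpha> in G. a < F \<alpha>"
    by eventually_elim simp
next
  fix a assume "ennreal L < a"
  then have "\<forall>\<^sub>F \<alpha> in G. ennreal (u \<alpha>) < a"
    using order_tendstoD(2)[OF tendsto_ennrealI[OF upper(2)]] by blast
  with upper(1) show "\<forall>\<^sub>F \<alpha> in G. F \<alpha> < a"
    by eventually_elim simp
qed

theorem theorem2:
  fixes A :: "'a::euclidean_space set"
  assumes "finite_perimeter A"
  shows "(\<forall>\<alpha>\<in>{0<..<1}. fractional_perimeter \<alpha> A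
            \<le> ennreal_powr (emeasure lebesgue A) (1 - \<alpha>) * ennreal_powr (perimeter A) \<alpha>) \<and>
         (emeasure lebesgue A < \<infinity> \<longrightarrow>
            ((\<lambda>\<alpha>. fractional_perimeter \<alpha> A) \<longlongrightarrow> emeasure lebesgue A) (at_right 0)) \<and>
         (emeasure lebesgue A < \<infinity> \<or> emeasure lebesgue (- A) < \<infinity> \<longrightarrow>
            ((\<lambda>\<alpha>. fractional_perimeter \<alpha> A) \<longlongrightarrow> perimeter A) (at_left 1))"
proof -
  have A: "A \<in> sets lebesgue" using assms by (simp add: finite_perimeter_def)
  define P where "P = enn2real (perimeter A)"
  have P: "perimeter A = ennreal P" "0 \<le> P"
    using assms by (auto simp: finite_perimeter_def P_def)
  have K_P: "K_functional t (indicator A) \<le> ennreal (t * P)" if "t > 0" for t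
    using K_functional_indicator_le_perimeter[OF assms, of t] P that by (simp add: ennreal_mult)
  note K_A = K_functional_indicator_le_measure[OF A]
  have m: "emeasure lebesgue A = ennreal (measure lebesgue A)" if "emeasure lebesgue A < \<infinity>"
    by (rule emeasure_eq_ennreal_measure) (use that in auto)
  have near_0: "\<forall>\<^sub>F \<alpha> in at_right 0. \<alpha> \<in> {0<..<1::real}"
    by (rule eventually_at_right_real) simp
  have near_1: "\<forall>\<^sub>F \<alpha> in at_left 1. \<alpha> \<in> {0<..<1::real}"
    by (rule eventually_at_left_real) simp

  have "fractional_perimeter \<alpha> A
      \<le> ennreal_powr (emeasure lebesgue A) (1 - \<alpha>) * ennreal_powr (perimeter A) \<alpha>"
    if \<alpha>: "0 < \<alpha>" "\<alpha> < 1" for \<alpha>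
  proof (cases "emeasure lebesgue A < \<infinity>")
    case True
    have "fractional_perimeter \<alpha> A \<le> ennreal (measure lebesgue A powr (1 - \<alpha>) * P powr \<alpha>)"
      using \<alpha> K_A K_P P m[OF True] by (intro fractional_perimeter_le) auto
    then show ?thesis
      using m[OF True] P by (simp add: ennreal_powr_def ennreal_mult')
  next
    case False
    \<comment> \<open>For \<open>P = 0\<close> the convention \<open>\<infinity> * 0 = 0\<close> makes the right-hand side vanish, but so does the K-functional.\<close>
    show ?thesis
    proof (cases "P = 0")
      case True
      then have "fractional_perimeter \<alpha> A \<le> ennreal (0 powr (1 - \<alpha>) * P powr \<alpha>)"
        using \<alpha> K_P by (intro fractional_perimeter_le) auto
      then show ?thesis using True by simp
    next
      case P0: False
      then have "ennreal_powr (perimeter A) \<alpha> \<noteq> 0"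
        using P by (simp add: ennreal_powr_def)
      then show ?thesis
        using False by (simp add: ennreal_powr_def ennreal_top_mult less_top[symmetric])
    qed
  qed
  moreover have "((\<lambda>\<alpha>. fractional_perimeter \<alpha> A) \<longlongrightarrow> emeasure lebesgue A) (at_right 0)"
    if fin: "emeasure lebesgue A < \<infinity>"
    unfolding m[OF fin]
  proof (rule tendsto_ennreal_sandwich)
    let ?m = "measure lebesgue A"
    \<comment> \<open>With \<open>P + 1 > 0\<close> the power tends to \<open>1\<close> also if the perimeter vanishes.\<close>
    have K_P': "K_functional t (indicator A) \<le> ennreal (t * (P + 1))" if "t > 0" for t
      using K_P[OF that] that by (elim order_trans) (simp add: ennreal_leI)
    show "\<forall>\<^sub>F \<alpha> in at_right 0. fractional_perimeter \<alpha> A \<le> ennreal (?m powr (1 - \<alpha>) * (P + 1) powr \<alpha>)"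
      using near_0
    proof eventually_elim
      case (elim \<alpha>)
      show ?case
        by (rule fractional_perimeter_le[OF _ _ _ _ K_A[unfolded m[OF fin]] K_P']) (use elim P(2) in auto)
    qed
    show "((\<lambda>\<alpha>. ?m powr (1 - \<alpha>) * (P + 1) powr \<alpha>) \<longlongrightarrow> ?m) (at_right 0)"
    proof (cases "?m = 0")
      case False
      then have "((\<lambda>\<alpha>. ?m powr (1 - \<alpha>) * (P + 1) powr \<alpha>) \<longlongrightarrow> ?m powr (1 - 0) * (P + 1) powr 0) (at_right 0)"
        using P by (intro tendsto_intros) auto
      then show ?thesis using False P by (simp add: zero_less_measure_iff)
    qed simp
    fix c assume c: "0 \<le> c" "c < ?m"
    obtain T where T: "T > 0" "\<And>t. T \<le> t \<Longrightarrow> ennreal c \<le> K_functional t (indicator A)"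
      using K_functional_indicator_ge_near_infinity[OF A fin c(2)] by blast
    show "\<exists>l. (\<forall>\<^sub>F \<alpha> in at_right 0. ennreal (l \<alpha>) \<le> fractional_perimeter \<alpha> A) \<and> (l \<longlongrightarrow> c) (at_right 0)"
    proof (intro exI conjI)
      show "\<forall>\<^sub>F \<alpha> in at_right 0. ennreal ((1 - \<alpha>) * c * T powr - \<alpha>) \<le> fractional_perimeter \<alpha> A"
        using near_0
      proof eventually_elim
        case (elim \<alpha>)
        then show ?case using c T by (intro fractional_perimeter_ge_near_infinity) auto
      qed
      have "((\<lambda>\<alpha>. (1 - \<alpha>) * c * T powr - \<alpha>) \<longlongrightarrow> (1 - 0) * c * T powr - 0) (at_right 0)"
        using T by (intro tendsto_intros) auto
      then show "((\<lambda>\<alpha>. (1 - \<alpha>) * c * T powr - \<alpha>) \<longlongrightarrow> c) (at_right 0)"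
        using T by simp
    qed
  qed
  moreover have "((\<lambda>\<alpha>. fractional_perimeter \<alpha> A) \<longlongrightarrow> perimeter A) (at_left 1)"
    if fin: "emeasure lebesgue A < \<infinity> \<or> emeasure lebesgue (- A) < \<infinity>"
  proof -
    have fin_le: "\<exists>k\<ge>0. x \<le> ennreal k" if "x < \<infinity>" for x :: ennreal
      using that by (cases x) auto
    from fin obtain k where k: "0 \<le> k"
      and "emeasure lebesgue A \<le> ennreal k \<or> emeasure lebesgue (- A) \<le> ennreal k"
      using fin_le by blast
    then have "K_functional t (indicator A) \<le> ennreal k" for t
      using K_A[of t] K_functional_indicator_le_measure_Compl[OF A, of t] by (auto intro: order_trans)
    \<comment> \<open>As for \<open>P + 1\<close> above, the shift makes the base of the power with exponent tending to \<open>0\<close> positive.\<close>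
    then have K_k: "K_functional t (indicator A) \<le> ennreal (k + 1)" for t
      by (rule order_trans) (intro ennreal_leI, simp)
    show ?thesis
      unfolding P(1)
    proof (rule tendsto_ennreal_sandwich)
      show "\<forall>\<^sub>F \<alpha> in at_left 1. fractional_perimeter \<alpha> A \<le> ennreal ((k + 1) powr (1 - \<alpha>) * P powr \<alpha>)"
        using near_1
      proof eventually_elim
        case (elim \<alpha>)
        show ?case
          by (rule fractional_perimeter_le[OF _ _ _ _ K_k K_P]) (use elim P(2) k in auto)
      qed
      show "((\<lambda>\<alpha>. (k + 1) powr (1 - \<alpha>) * P powr \<alpha>) \<longlongrightarrow> P) (at_left 1)"
      proof (cases "P = 0")
        case False
        then have "((\<lambda>\<alpha>. (k + 1) powr (1 - \<alpha>) * P powr \<alpha>) \<longlongrightarrow> (k + 1) powr (1 - 1) * P powr 1) (at_left 1)"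
          using k by (intro tendsto_intros) auto
        then show ?thesis using P k by simp
      qed simp
      fix c assume c: "0 \<le> c" "c < P"
      then have "ennreal c < perimeter A" using P by (simp add: ennreal_less_iff)
      then obtain s where s: "s > 0" "\<And>t. 0 < t \<Longrightarrow> t \<le> s \<Longrightarrow> ennreal (t * c) \<le> K_functional t (indicator A)"
        using K_functional_indicator_ge_near_0[OF A] by blast
      show "\<exists>l. (\<forall>\<^sub>F \<alpha> in at_left 1. ennreal (l \<alpha>) \<le> fractional_perimeter \<alpha> A) \<and> (l \<longlongrightarrow> c) (at_left 1)"
      proof (intro exI conjI)
        show "\<forall>\<^sub>F \<alpha> in at_left 1. ennreal (\<alpha> * c * s powr (1 - \<alpha>)) \<le> fractional_perimeter \<alpha> A"
          using near_1
        proof eventually_elim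
          case (elim \<alpha>)
          then show ?case using c s by (intro fractional_perimeter_ge_near_0) auto
        qed
        have "((\<lambda>\<alpha>. \<alpha> * c * s powr (1 - \<alpha>)) \<longlongrightarrow> 1 * c * s powr (1 - 1)) (at_left 1)"
          using s by (intro tendsto_intros) auto
        then show "((\<lambda>\<alpha>. \<alpha> * c * s powr (1 - \<alpha>)) \<longlongrightarrow> c) (at_left 1)"
          using s by simp
      qed
    qed
  qed
  ultimately show ?thesis by simp
qed

end
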